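(* Let $m,n$ be positive integers and $p\le\min\{m,n\}$ a nonnegative integer. Let $G(m,n,p)$ be the graph with vertex set $\{x_1,\dots,x_m\}\cup\{y_1,\dots,y_n\}$ and edge set $\{x_iy_j:1\le i\le m,1\le j\le n\}\setminus\{x_1y_1,\dots,x_py_p\}$, with unit resistance on each edge, and let $R_{uv}$ denote the effective resistance between vertices $u,v$. Write $[k]=\{1,\dots,k\}$ for $k\ge1$ and $[0]=\emptyset$. Then: (1) for $1\le i,j\le m$: $R_{x_ix_j}=\frac{2(m-1)}{mn-m-n}$ if $i\ne j$ and $i,j\in[p]$; $R_{x_ix_j}=\frac{2}{n}$ if $i\ne j$ and $i,j\in[m]\setminus[p]$; $R_{x_ix_j}=\frac{2n-1}{n(n-1)}+\frac{p-1}{p(n-1)(mn-m-n)}+\frac{n-p}{pn(n-1)(mn-m-n+p)}$ if $i\in[p]$, $j\in[m]\setminus[p]$. (2) for $1\le i,j\le n$: $R_{y_iy_j}=\frac{2(n-1)}{mn-m-n}$ if $i\ne j$ and $i,j\in[p]$; $R_{y_iy_j}=\frac{2}{m}$ if $i\ne j$ and $i,j\in[n]\setminus[p]$; $R_{y_iy_j}=\frac{2m-1}{m(m-1)}+\frac{p-1}{p(m-1)(mn-m-n)}+\frac{m-p}{pm(m-1)(mn-m-n+p)}$ if $i\in[p]$, $j\in[n]\setminus[p]$. (3) for $1\le i\le m$, $1\le j\le n$: $R_{x_iy_j}=\frac{m+n}{mn-m-n}-\frac{mn}{(mn-m-n)(mn-m-n+p)}$ if $i=j\in[p]$; $R_{x_iy_j}=\frac{m+n-2}{mn-m-n}-\frac{mn}{(mn-m-n)(mn-m-n+p)}$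 if $i\ne j$ and $i,j\in[p]$; $R_{x_iy_j}=\frac1m+\frac{(p-1)(m-1)}{p(mn-m-n)}+\frac{(m-p)(m-1)}{pm(mn-m-n+p)}$ if $i\in[p]$, $j\in[n]\setminus[p]$; $R_{x_iy_j}=\frac1n+\frac{(p-1)(n-1)}{p(mn-m-n)}+\frac{(n-p)(n-1)}{pn(mn-m-n+p)}$ if $i\in[m]\setminus[p]$, $j\in[p]$; $R_{x_iy_j}=\frac1m+\frac1n-\frac{mn-m-n}{mn(mn-m-n+p)}$ if $i\in[m]\setminus[p]$, $j\in[n]\setminus[p]$.
   Context: The effective resistance (resistance distance) $R_{uv}$ between vertices $u,v$ of a connected graph $G$ whose edges are resistors is the potential difference $U_{uv}$ divided by the current $I$ when a current $I$ is injected at $u$ and extracted at $v$ (currents and potentials obeying Ohm's law and Kirchhoff's laws). Equivalently, with unit resistances, $R_{uv}=\tau(G/\{u,v\})/\tau(G)$, where $\tau$ counts spanning trees and $G/\{u,v\}$ identifies $u$ and $v$ (deleting loops).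
   Formalization: G(m,n,p) is assumed connected (this excludes m=p=1, n=p=1 and m=n=p=2), and in (3) the case i=j∈[p] assumes mn-m-n≠0 (excludes m=n=2, p=1) and the last case assumes mn-m-n+p≠0 (excludes m=n=2, p=0), where the printed formulas divide by zero. *)

theory Defs
  imports Complex_Main "Graph_Theory.Graph_Theory"
begin

(* An undirected graph is a symmetric digraph: the edge joining x and y is the pair of opposite
   arcs (x, y), (y, x).  The resistance r is indexed by the unordered pair {x, y}, so that the
   current c satisfies c (y, x) = - c (x, y) by Ohm's law.  Kirchhoff's voltage law is built in:
   the voltages are differences of a potential f. *)

definition ohm_law ::
    "'a pair_pre_digraph \<Rightarrow> ('a set \<Rightarrow> real) \<Rightarrow> ('a \<Rightarrow> real) \<Rightarrow> ('a \<times> 'a \<Rightarrow> real) \<Rightarrow> bool" where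
  "ohm_law G r f c \<longleftrightarrow> (\<forall>(x, y) \<in> parcs G. f x - f y = r {x, y} * c (x, y))"

(* Current I enters the network at u and leaves it at v. *)
definition kirchhoff_current_law ::
    "'a pair_pre_digraph \<Rightarrow> 'a \<Rightarrow> 'a \<Rightarrow> real \<Rightarrow> ('a \<times> 'a \<Rightarrow> real) \<Rightarrow> bool" where
  "kirchhoff_current_law G u v I c \<longleftrightarrow>
     (\<forall>x \<in> pverts G. (\<Sum>e \<in> out_arcs (with_proj G) x. c e)
        = (if x = u then I else 0) - (if x = v then I else 0))"

(* Well defined when G is finite, symmetric and connected, r is positive on its edges and u, v
   are vertices. *)
definition effective_resistance ::
    "'a pair_pre_digraph \<Rightarrow> ('a set \<Rightarrow> real) \<Rightarrow> 'a \<Rightarrow> 'a \<Rightarrow> real" where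
  "effective_resistance G r u v =
     (THE R. \<exists>I f c. I \<noteq> 0 \<and> ohm_law G r f c \<and> kirchhoff_current_law G u v I c
        \<and> R = (f u - f v) / I)"

datatype vertex = X nat | Y nat

definition bipartite_edges :: "nat \<Rightarrow> nat \<Rightarrow> nat \<Rightarrow> vertex rel" where
  "bipartite_edges m n p =
     {(X i, Y j) | i j. i \<in> {1..m} \<and> j \<in> {1..n}} - {(X k, Y k) | k. k \<in> {1..p}}"

definition bipartite_minus_matching :: "nat \<Rightarrow> nat \<Rightarrow> nat \<Rightarrow> vertex pair_pre_digraph" where
  "bipartite_minus_matching m n p =
     \<lparr> pverts = X ` {1..m} \<union> Y ` {1..n},
       parcs = bipartite_edges m n p \<union> (bipartite_edges m n p)\<inverse> \<rparr>"

abbreviation unit_resistance :: "nat \<Rightarrow> nat \<Rightarrow> nat \<Rightarrow> vertex \<Rightarrow> vertex \<Rightarrow> real" where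
  "unit_resistance m n p \<equiv> effective_resistance (bipartite_minus_matching m n p) (\<lambda>_. 1)"

end

theory Submission
  imports Defs
begin

text \<open>
  Effective resistance is read off any potential satisfying Kirchhoff's law for a unit current, so
  it suffices to exhibit one. With the \<open>Y\<close> potentials normalised to sum 0 and the sum \<open>A\<close> of the
  \<open>X\<close> potentials as parameter, the equations decouple: an unmatched vertex has one equation of its own,
  and a matched pair \<open>X i\<close>, \<open>Y i\<close> has a 2 by 2 system of determinant \<open>D = mn - m - n\<close>. Summing over
  the vertices then gives \<open>A\<close> after division by \<open>D + p\<close>. Connectedness leaves \<open>D = 0\<close> only for
  \<open>m = n = 2\<close> with \<open>p \<le> 1\<close>, a 4-cycle or a path, where potentials are given by hand.
\<close>

section \<open>Power sums and reciprocity in a resistor network\<close>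

text \<open>Group the arcs by tail; Kirchhoff's law evaluates each inner sum. The weight
  \<open>g\<close> is arbitrary, so it may be the potential of a different flow.\<close>

lemma kirchhoff_power:
  assumes fin: "finite (pverts G)" and wf: "parcs G \<subseteq> pverts G \<times> pverts G"
    and uv: "u \<in> pverts G" "v \<in> pverts G"
    and K: "kirchhoff_current_law G u v I c"
  shows "(\<Sum>e\<in>parcs G. g (fst e) * c e) = (g u - g v) * I"
proof -
  have finA: "finite (parcs G)"
    using fin wf by (meson finite_SigmaI finite_subset)
  have "(\<Sum>e\<in>parcs G. g (fst e) * c e)
      = (\<Sum>x\<in>pverts G. \<Sum>e\<in>{e \<in> parcs G. fst e = x}. g (fst e) * c e)"
    using wf by (intro sum.group[symmetric] finA fin) auto
  also have "\<dots> = (\<Sum>x\<in>pverts G. g x * (\<Sum>e\<in>out_arcs (with_proj G) x. c e))"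
    by (auto simp: out_arcs_def sum_distrib_left intro!: sum.cong)
  also have "\<dots> = (\<Sum>x\<in>pverts G. g x * ((if x = u then I else 0) - (if x = v then I else 0)))"
    using K by (simp add: kirchhoff_current_law_def)
  also have "\<dots> = (\<Sum>x\<in>pverts G. (if x = u then g x * I else 0) - (if x = v then g x * I else 0))"
    by (intro sum.cong) (auto simp: algebra_simps)
  also have "\<dots> = (g u - g v) * I"
    using fin uv by (simp add: sum_subtractf algebra_simps)
  finally show ?thesis .
qed

text \<open>Pair each flow with the potential of the other. The difference of the two power sums
  changes sign when every arc is reversed, so it vanishes on a symmetric arc set.\<close>

lemma ohm_kirchhoff_reciprocity:
  assumes fin: "finite (pverts G)" and wf: "parcs G \<subseteq> pverts G \<times> pverts G"
    and sym: "sym (parcs G)" and r: "\<And>x y. (x, y) \<in> parcs G \<Longrightarrow> r {x, y} \<noteq> 0"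
    and uv: "u \<in> pverts G" "v \<in> pverts G"
    and f: "ohm_law G r f c" "kirchhoff_current_law G u v I c"
    and g: "ohm_law G r g d" "kirchhoff_current_law G u v J d"
  shows "(g u - g v) * I = (f u - f v) * J"
proof -
  \<comment> \<open>On an arc, Ohm's law gives
    \<open>h (x, y) = (f x * g y - g x * f y) / r {x, y}\<close>, which is antisymmetric.\<close>
  define h where "h e = g (fst e) * c e - f (fst e) * d e" for e
  have anti: "h (y, x) = - h (x, y)" if xy: "(x, y) \<in> parcs G" for x y
  proof -
    have yx: "(y, x) \<in> parcs G" using xy sym by (meson symD)
    have xy_currents: "c (x, y) = (f x - f y) / r {x, y}" "d (x, y) = (g x - g y) / r {x, y}"
      using f(1) g(1) xy r[OF xy] by (auto simp: ohm_law_def field_simps)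
    have yx_currents: "c (y, x) = (f y - f x) / r {x, y}" "d (y, x) = (g y - g x) / r {x, y}"
      using f(1) g(1) yx r[OF yx] by (auto simp: ohm_law_def field_simps insert_commute)
    show ?thesis
      unfolding h_def fst_conv xy_currents yx_currents
      using r[OF xy] by (simp add: divide_simps) (simp add: algebra_simps)
  qed
  have "sum h (parcs G) = (\<Sum>e\<in>parcs G. h (prod.swap e))"
    using sym by (intro sum.reindex_bij_witness[where i = prod.swap and j = prod.swap])
      (auto dest: symD)
  also have "\<dots> = - sum h (parcs G)"
    by (auto simp: sum_negf[symmetric] anti intro!: sum.cong)
  finally have "sum h (parcs G) = 0" by simp
  thus ?thesis
    using kirchhoff_power[OF fin wf uv f(2), of g] kirchhoff_power[OF fin wf uv g(2), of f]
    by (simp add: h_def sum_subtractf)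
qed

text \<open>Reciprocity makes the value of the definite description unique, without connectedness.\<close>

lemma effective_resistance_eqI:
  assumes "finite (pverts G)" "parcs G \<subseteq> pverts G \<times> pverts G" "sym (parcs G)"
    and "\<And>x y. (x, y) \<in> parcs G \<Longrightarrow> r {x, y} \<noteq> 0"
    and "u \<in> pverts G" "v \<in> pverts G"
    and f: "ohm_law G r f c" "kirchhoff_current_law G u v 1 c"
  shows "effective_resistance G r u v = f u - f v"
  unfolding effective_resistance_def
proof (rule the_equality)
  show "\<exists>I g d. I \<noteq> 0 \<and> ohm_law G r g d \<and> kirchhoff_current_law G u v I d
      \<and> f u - f v = (g u - g v) / I"
    using f by (intro exI[of _ 1] exI[of _ f] exI[of _ c]) simp
next
  fix R
  assume "\<exists>I g d. I \<noteq> 0 \<and> ohm_law G r g d \<and> kirchhoff_current_law G u v I d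
      \<and> R = (g u - g v) / I"
  then obtain I g d where g: "I \<noteq> 0" "ohm_law G r g d" "kirchhoff_current_law G u v I d"
    and R: "R = (g u - g v) / I" by blast
  have "(g u - g v) * 1 = (f u - f v) * I"
    by (rule ohm_kirchhoff_reciprocity[of G r u v f c 1 g d I]) (use assms g in auto)
  thus "R = f u - f v"
    using R g(1) by simp
qed

section \<open>Connectedness through closed vertex sets\<close>

text \<open>Induction along a path. It serves to refute connectedness: it is enough to name a set
  closed under arcs that contains one vertex and misses another.\<close>

lemma connected_closed_set:
  assumes conn: "connected (with_proj G)" and sym: "sym (parcs G)"
    and x: "x \<in> pverts G" "x \<in> S"
    and closed: "\<And>y z. (y, z) \<in> parcs G \<Longrightarrow> y \<in> S \<Longrightarrow> z \<in> S"
  shows "pverts G \<subseteq> S"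
proof
  fix y assume "y \<in> pverts G"
  hence "x \<rightarrow>\<^sup>*\<^bsub>with_proj (mk_symmetric (with_proj G))\<^esub> y"
    using conn x by (auto simp: connected_def strongly_connected_def)
  thus "y \<in> S"
    unfolding reachable_def
  proof (induction rule: rtrancl_on_induct)
    case base
    show ?case using x by simp
  next
    case (step y z)
    \<comment> \<open>The path runs in the symmetric closure, which has no further arcs because
      \<open>parcs G\<close> is already symmetric.\<close>
    hence "(y, z) \<in> parcs G"
      using sym by (auto simp: parcs_mk_symmetric dest: symD)
    thus ?case using closed step by blast
  qed
qed

section \<open>Kirchhoff's equations for the bipartite graph\<close>

lemma finite_pverts_bipartite: "finite (pverts (bipartite_minus_matching m n p))"
  by (simp add: bipartite_minus_matching_def)

lemma parcs_bipartite_subset: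
  "parcs (bipartite_minus_matching m n p)
     \<subseteq> pverts (bipartite_minus_matching m n p) \<times> pverts (bipartite_minus_matching m n p)"
  by (auto simp: bipartite_minus_matching_def bipartite_edges_def)

lemma sym_parcs_bipartite: "sym (parcs (bipartite_minus_matching m n p))"
  by (auto simp: bipartite_minus_matching_def intro: symI)

lemma out_arcs_bipartite_X:
  assumes "i \<in> {1..m}"
  shows "out_arcs (with_proj (bipartite_minus_matching m n p)) (X i)
    = (\<lambda>j. (X i, Y j)) ` ({1..n} - (if i \<le> p then {i} else {}))"
  using assms by (auto simp: out_arcs_def bipartite_minus_matching_def bipartite_edges_def)

lemma out_arcs_bipartite_Y:
  assumes "j \<in> {1..n}"
  shows "out_arcs (with_proj (bipartite_minus_matching m n p)) (Y j)
    = (\<lambda>i. (Y j, X i)) ` ({1..m} - (if j \<le> p then {j} else {}))"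
  using assms by (auto simp: out_arcs_def bipartite_minus_matching_def bipartite_edges_def)

text \<open>The current out of a vertex of potential \<open>a\<close>, for either side of the
  bipartition. The bound \<open>p \<le> n\<close> ensures that the removed partner occurs in
  \<open>{1..n}\<close>.\<close>

lemma sum_diff_removed:
  fixes b :: "nat \<Rightarrow> real"
  assumes "i \<in> {1..k}" "p \<le> n"
  shows "(\<Sum>j\<in>{1..n} - (if i \<le> p then {i} else {}). a - b j)
    = real n * a - (\<Sum>j=1..n. b j) - (if i \<le> p then a - b i else 0)"
  using assms by (auto simp: sum_diff1 sum_subtractf algebra_simps)

text \<open>With unit resistances the current is the potential difference, so only Kirchhoff's law
  is left. Each equation is written as for the complete bipartite graph minus the missing edge, so
  the potentials of the other side enter only through their total and the partner.\<close>

lemma unit_resistance_eqI: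
  fixes f :: "vertex \<Rightarrow> real"
  assumes p: "p \<le> m" "p \<le> n"
    and uv: "u \<in> X ` {1..m} \<union> Y ` {1..n}" "v \<in> X ` {1..m} \<union> Y ` {1..n}"
    and X: "\<And>i. i \<in> {1..m} \<Longrightarrow>
      real n * f (X i) - (\<Sum>j=1..n. f (Y j)) - (if i \<le> p then f (X i) - f (Y i) else 0)
        = of_bool (X i = u) - of_bool (X i = v)"
    and Y: "\<And>j. j \<in> {1..n} \<Longrightarrow>
      real m * f (Y j) - (\<Sum>i=1..m. f (X i)) - (if j \<le> p then f (Y j) - f (X j) else 0)
        = of_bool (Y j = u) - of_bool (Y j = v)"
  shows "unit_resistance m n p u v = f u - f v"
proof (rule effective_resistance_eqI)
  let ?G = "bipartite_minus_matching m n p" and ?c = "\<lambda>e. f (fst e) - f (snd e)"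
  show "u \<in> pverts ?G" "v \<in> pverts ?G"
    using uv by (simp_all add: bipartite_minus_matching_def)
  show "ohm_law ?G (\<lambda>_. 1) f ?c"
    by (auto simp: ohm_law_def)
  have "(\<Sum>e\<in>out_arcs (with_proj ?G) (X i). ?c e) = of_bool (X i = u) - of_bool (X i = v)"
    if "i \<in> {1..m}" for i
  proof -
    have "(\<Sum>e\<in>out_arcs (with_proj ?G) (X i). ?c e)
        = (\<Sum>j\<in>{1..n} - (if i \<le> p then {i} else {}). f (X i) - f (Y j))"
      unfolding out_arcs_bipartite_X[OF that]
      by (subst sum.reindex) (auto simp: inj_on_def)
    thus ?thesis
      using sum_diff_removed[OF that p(2), of "f (X i)" "\<lambda>j. f (Y j)"] X[OF that] by simp
  qed
  moreover have "(\<Sum>e\<in>out_arcs (with_proj ?G) (Y j). ?c e) = of_bool (Y j = u) - of_bool (Y j = v)"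
    if "j \<in> {1..n}" for j
  proof -
    have "(\<Sum>e\<in>out_arcs (with_proj ?G) (Y j). ?c e)
        = (\<Sum>i\<in>{1..m} - (if j \<le> p then {j} else {}). f (Y j) - f (X i))"
      unfolding out_arcs_bipartite_Y[OF that]
      by (subst sum.reindex) (auto simp: inj_on_def)
    thus ?thesis
      using sum_diff_removed[OF that p(1), of "f (Y j)" "\<lambda>i. f (X i)"] Y[OF that] by simp
  qed
  ultimately show "kirchhoff_current_law ?G u v 1 ?c"
    unfolding kirchhoff_current_law_def
    by (auto simp: bipartite_minus_matching_def of_bool_def)
qed (simp_all add: finite_pverts_bipartite parcs_bipartite_subset sym_parcs_bipartite)

section \<open>The explicit potential\<close>

lemma sum_if_le:
  fixes g h :: "nat \<Rightarrow> real"
  assumes "p \<le> n"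
  shows "(\<Sum>i=1..n. if i \<le> p then g i else h i) = (\<Sum>i=1..p. g i) + (\<Sum>i=p+1..n. h i)"
proof -
  have "{1..n} = {1..p} \<union> {p+1..n}" using assms by auto
  hence "(\<Sum>i=1..n. if i \<le> p then g i else h i)
      = (\<Sum>i=1..p. if i \<le> p then g i else h i) + (\<Sum>i=p+1..n. if i \<le> p then g i else h i)"
    by (simp only:) (subst sum.union_disjoint; auto)
  thus ?thesis by simp
qed

text \<open>Here \<open>s\<close> and \<open>t\<close> are the injected currents. If the
  \<open>Y\<close> potentials sum to 0 and the \<open>X\<close> potentials to \<open>A\<close>, a
  matched pair with potentials x, y satisfies (n - 1) x + y = s and x + (m - 1) y = t + A;
  \<open>f\<close> is Cramer's rule for this system. \<open>A\<close> solves the equation obtained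
  by summing the \<open>X\<close> values of \<open>f\<close>.\<close>

lemma unit_resistance_eq:
  fixes m n p :: nat and u v :: vertex
  defines "D \<equiv> real m * real n - real m - real n"
    and "s \<equiv> \<lambda>i. of_bool (X i = u) - of_bool (X i = v) :: real"
    and "t \<equiv> \<lambda>j. of_bool (Y j = u) - of_bool (Y j = v) :: real"
  defines "A \<equiv> (D * (\<Sum>i=p+1..m. s i) / real n + (real m - 1) * (\<Sum>i=1..p. s i) - (\<Sum>j=1..p. t j))
    / (D + real p)"
  defines "f \<equiv> \<lambda>w. case w of
      X i \<Rightarrow> if i \<le> p then ((real m - 1) * s i - t i - A) / D else s i / real n
    | Y j \<Rightarrow> if j \<le> p then ((real n - 1) * (t j + A) - s j) / D else (t j + A) / real m"
  assumes mn: "m \<ge> 1" "n \<ge> 1" and p: "p \<le> m" "p \<le> n"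
    and uv: "u \<in> X ` {1..m} \<union> Y ` {1..n}" "v \<in> X ` {1..m} \<union> Y ` {1..n}"
    and D: "D \<noteq> 0" "D + real p \<noteq> 0"
  shows "unit_resistance m n p u v = f u - f v"
proof -
  define SP SN TP TN where
    "SP = (\<Sum>i=1..p. s i)" and "SN = (\<Sum>i=p+1..m. s i)" and
    "TP = (\<Sum>j=1..p. t j)" and "TN = (\<Sum>j=p+1..n. t j)"
  have mn0: "real m \<noteq> 0" "real n \<noteq> 0" using mn by auto
  have charge: "(\<Sum>i=1..m. of_bool (X i = w)) + (\<Sum>j=1..n. of_bool (Y j = w)) = (1::real)"
    if "w \<in> X ` {1..m} \<union> Y ` {1..n}" for w
    using that by (auto simp: of_bool_def)
  \<comment> \<open>The total injected current is zero; this eliminates \<open>TN\<close> and is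
    what makes the normalisation of the \<open>Y\<close> potentials consistent.\<close>
  have "(\<Sum>i=1..m. s i) + (\<Sum>j=1..n. t j) = 0"
    using charge[OF uv(1)] charge[OF uv(2)] by (simp add: s_def t_def sum_subtractf)
  moreover have "(\<Sum>i=1..m. s i) = SP + SN" "(\<Sum>j=1..n. t j) = TP + TN"
    using sum_if_le[OF p(1), of s s] sum_if_le[OF p(2), of t t]
    by (simp_all add: SP_def SN_def TP_def TN_def)
  ultimately have TN: "TN = - SP - SN - TP" by simp
  have A: "(D + real p) * A = D * SN / real n + (real m - 1) * SP - TP"
    using D(2) by (simp add: A_def SP_def SN_def TP_def)
  have "(\<Sum>i=1..m. f (X i)) = ((real m - 1) * SP - TP - real p * A) / D + SN / real n"
    using sum_if_le[OF p(1), of "\<lambda>i. ((real m - 1) * s i - t i - A) / D" "\<lambda>i. s i / real n"]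
    by (simp add: f_def SP_def SN_def TP_def sum_subtractf sum_distrib_left sum_divide_distrib
        diff_divide_distrib)
  also have "\<dots> = A"
    using A D mn0 by (simp add: field_simps)
  finally have sumX: "(\<Sum>i=1..m. f (X i)) = A" .
  have "(\<Sum>j=1..n. f (Y j))
      = ((real n - 1) * (TP + real p * A) - SP) / D + (TN + (real n - real p) * A) / real m"
    using sum_if_le[OF p(2), of "\<lambda>j. ((real n - 1) * (t j + A) - s j) / D" "\<lambda>j. (t j + A) / real m"] p
    by (simp add: f_def SP_def TN_def TP_def sum_subtractf sum.distrib flip: sum_distrib_left sum_divide_distrib)
  \<comment> \<open>Once \<open>TN\<close> is eliminated, the sum is a multiple of the defect in the
    defining equation of \<open>A\<close>.\<close>
  also have "\<dots> = real n * ((D + real p) * A - (D * SN / real n + (real m - 1) * SP - TP)) / (D * real m)"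
    using D mn0 by (simp add: TN divide_simps) (simp add: D_def algebra_simps)
  also have "\<dots> = 0" using A by simp
  finally have sumY: "(\<Sum>j=1..n. f (Y j)) = 0" .
  show ?thesis
  proof (rule unit_resistance_eqI[OF p uv])
    fix i assume "i \<in> {1..m}"
    have "real n * f (X i) - (\<Sum>j=1..n. f (Y j)) - (if i \<le> p then f (X i) - f (Y i) else 0) = s i"
      unfolding sumY
      using D mn0 by (simp add: f_def divide_simps) (simp add: D_def algebra_simps)
    thus "real n * f (X i) - (\<Sum>j=1..n. f (Y j)) - (if i \<le> p then f (X i) - f (Y i) else 0)
        = of_bool (X i = u) - of_bool (X i = v)"
      by (simp only: s_def t_def)
  next
    fix j assume "j \<in> {1..n}"
    have "real m * f (Y j) - (\<Sum>i=1..m. f (X i)) - (if j \<le> p then f (Y j) - f (X j) else 0) = t j"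
      unfolding sumX
      using D mn0 by (simp add: f_def divide_simps) (simp add: D_def algebra_simps)
    thus "real m * f (Y j) - (\<Sum>i=1..m. f (X i)) - (if j \<le> p then f (Y j) - f (X j) else 0)
        = of_bool (Y j = u) - of_bool (Y j = v)"
      by (simp only: s_def t_def)
  qed
qed

section \<open>Parameters excluded by connectedness\<close>

text \<open>As p > 0, the edge between \<open>X 1\<close> and \<open>Y 1\<close> is missing. In each
  excluded case some closed set separates these two vertices.\<close>

lemma connected_bipartite:
  assumes mn: "m \<ge> 1" "n \<ge> 1" and p: "p \<le> min m n" "p > 0"
    and conn: "connected (with_proj (bipartite_minus_matching m n p))"
  shows "m \<ge> 2" "n \<ge> 2" "\<not> (m = 2 \<and> n = 2 \<and> p = 2)"
proof -
  let ?G = "bipartite_minus_matching m n p"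
  have closed: "X 1 \<in> S \<Longrightarrow> (\<And>y z. (y, z) \<in> parcs ?G \<Longrightarrow> y \<in> S \<Longrightarrow> z \<in> S) \<Longrightarrow> Y 1 \<in> S" for S
    using connected_closed_set[OF conn sym_parcs_bipartite, of "X 1" S] mn
    by (auto simp: bipartite_minus_matching_def)
  \<comment> \<open>For m = 1 the vertex \<open>Y 1\<close> is isolated.\<close>
  show "m \<ge> 2"
    using closed[of "- {Y 1}"] mn p
    by (force simp: bipartite_minus_matching_def bipartite_edges_def)
  \<comment> \<open>For n = 1 the vertex \<open>X 1\<close> is isolated.\<close>
  show "n \<ge> 2"
    using closed[of "{X 1}"] mn p
    by (force simp: bipartite_minus_matching_def bipartite_edges_def)
  show "\<not> (m = 2 \<and> n = 2 \<and> p = 2)"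
  proof
    assume *: "m = 2 \<and> n = 2 \<and> p = 2"
    \<comment> \<open>Two disjoint edges remain, and \<open>{X 1, Y 2}\<close> is one of the
      components.\<close>
    have "Y 1 \<in> {X 1, Y 2}"
      by (rule closed) (use * in \<open>auto simp: bipartite_minus_matching_def bipartite_edges_def\<close>)
    thus False by simp
  qed
qed

section \<open>Unmatched vertices on one side, and the path on four vertices\<close>

text \<open>Both terminals are adjacent to every \<open>Y\<close> vertex, so a potential vanishing
  at all other vertices works. Nothing is divided by D, so the 4-cycle is covered too.\<close>

lemma unit_resistance_unmatched_X:
  assumes "n \<ge> 1" "p \<le> m" "p \<le> n" "i \<noteq> j" "i \<in> {1..m} - {1..p}" "j \<in> {1..m} - {1..p}"
  shows "unit_resistance m n p (X i) (X j) = 2 / real n"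
proof -
  define f where "f w = (of_bool (w = X i) - of_bool (w = X j)) / real n" for w
  have "(\<Sum>k=1..m. f (X k)) = 0"
    using assms by (simp add: f_def sum_subtractf of_bool_def flip: sum_divide_distrib)
  hence "unit_resistance m n p (X i) (X j) = f (X i) - f (X j)"
    using assms by (intro unit_resistance_eqI) (auto simp: f_def)
  thus ?thesis using assms by (simp add: f_def)
qed

lemma unit_resistance_unmatched_Y:
  assumes "m \<ge> 1" "p \<le> m" "p \<le> n" "i \<noteq> j" "i \<in> {1..n} - {1..p}" "j \<in> {1..n} - {1..p}"
  shows "unit_resistance m n p (Y i) (Y j) = 2 / real m"
proof -
  define f where "f w = (of_bool (w = Y i) - of_bool (w = Y j)) / real m" for w
  have "(\<Sum>k=1..n. f (Y k)) = 0"
    using assms by (simp add: f_def sum_subtractf of_bool_def flip: sum_divide_distrib)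
  hence "unit_resistance m n p (Y i) (Y j) = f (Y i) - f (Y j)"
    using assms by (intro unit_resistance_eqI) (auto simp: f_def)
  thus ?thesis using assms by (simp add: f_def)
qed

text \<open>For \<open>m = n = 2\<close> and \<open>p = 1\<close> the graph is the path \<open>X 1, Y 2, X 2, Y 1\<close>.\<close>

lemma unit_resistance_path:
  "unit_resistance 2 2 1 (X 1) (X 2) = 2"
  "unit_resistance 2 2 1 (Y 1) (Y 2) = 2"
  "unit_resistance 2 2 1 (X 1) (Y 2) = 1"
  "unit_resistance 2 2 1 (X 2) (Y 1) = 1"
  "unit_resistance 2 2 1 (X 2) (Y 2) = 1"
proof -
  have two: "{Suc 0..2} = {1, 2}" by auto
  have path: "unit_resistance 2 2 1 u v = f u - f v"
    if "u \<in> {X 1, X 2, Y 1, Y 2}" "v \<in> {X 1, X 2, Y 1, Y 2}"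
      "f (X 1) - f (Y 2) = of_bool (X 1 = u) - of_bool (X 1 = v)"
      "2 * f (X 2) - f (Y 1) - f (Y 2) = of_bool (X 2 = u) - of_bool (X 2 = v)"
      "f (Y 1) - f (X 2) = of_bool (Y 1 = u) - of_bool (Y 1 = v)"
      "2 * f (Y 2) - f (X 1) - f (X 2) = of_bool (Y 2 = u) - of_bool (Y 2 = v)"
    for u v and f :: "vertex \<Rightarrow> real"
    by (rule unit_resistance_eqI) (use that in \<open>auto simp: two\<close>)
  \<comment> \<open>In all five cases the potential drops by 1 along each edge between the terminals
    and is constant beyond them.\<close>
  show "unit_resistance 2 2 1 (X 1) (X 2) = 2"
    by (subst path[where f = "\<lambda>w. if w = X 1 then 2 else if w = Y 2 then 1 else 0"]) auto
  show "unit_resistance 2 2 1 (Y 1) (Y 2) = 2"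
    by (subst path[where f = "\<lambda>w. if w = Y 1 then 2 else if w = X 2 then 1 else 0"]) auto
  show "unit_resistance 2 2 1 (X 1) (Y 2) = 1"
    by (subst path[where f = "\<lambda>w. of_bool (w = X 1)"]) auto
  show "unit_resistance 2 2 1 (X 2) (Y 1) = 1"
    by (subst path[where f = "\<lambda>w. of_bool (w \<noteq> Y 1)"]) auto
  show "unit_resistance 2 2 1 (X 2) (Y 2) = 1"
    by (subst path[where f = "\<lambda>w. of_bool (w = X 2 \<or> w = Y 1)"]) auto
qed

section \<open>Resistance formulas in the nondegenerate case\<close>

context
  fixes m n p :: nat and D :: real
  assumes mn: "m \<ge> 1" "n \<ge> 1" and p: "p \<le> m" "p \<le> n"
    and matched: "p > 0 \<longrightarrow> m \<ge> 2 \<and> n \<ge> 2"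
    and D_def: "D = real m * real n - real m - real n"
    and D: "D \<noteq> 0" "D + real p \<noteq> 0"
begin

lemmas potential = unit_resistance_eq[OF mn p, folded D_def, OF _ _ D]

lemma mn_nonzero: "real m \<noteq> 0" "real n \<noteq> 0"
  using mn by auto

lemma matched_nonzero:
  assumes "k \<in> {1..p}"
  shows "real p \<noteq> 0" "real m - 1 \<noteq> 0" "real n - 1 \<noteq> 0"
  using assms matched by auto

text \<open>Source and sink cancel in the sum over matched \<open>X\<close> vertices, so
  \<open>A\<close> is 0. The same happens for two matched \<open>Y\<close> vertices.\<close>

lemma unit_resistance_matched_X:
  assumes "i \<noteq> j" "i \<in> {1..p}" "j \<in> {1..p}"
  shows "unit_resistance m n p (X i) (X j) = 2 * (real m - 1) / D"
  using assms p by (subst potential)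
    (auto simp: sum_subtractf of_bool_def diff_divide_distrib)

lemma unit_resistance_matched_Y:
  assumes "i \<noteq> j" "i \<in> {1..p}" "j \<in> {1..p}"
  shows "unit_resistance m n p (Y i) (Y j) = 2 * (real n - 1) / D"
  using assms p D mn_nonzero by (subst potential)
    (auto simp: sum_subtractf of_bool_def divide_simps)

text \<open>Here \<open>A\<close> is (m - 1 - D/n) / (D + p), that is m / (n (D + p)).\<close>

lemma unit_resistance_matched_unmatched_X:
  assumes "i \<in> {1..p}" "j \<in> {1..m} - {1..p}"
  shows "unit_resistance m n p (X i) (X j) = (2 * real n - 1) / (real n * (real n - 1))
    + (real p - 1) / (real p * (real n - 1) * D)
    + (real n - real p) / (real p * real n * (real n - 1) * (D + real p))"
proof -
  have "i \<noteq> j" "p < j" using assms by auto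
  thus ?thesis
    using assms p D mn_nonzero matched_nonzero[OF assms(1)]
    by (subst potential; simp add: image_iff sum_subtractf sum_negf of_bool_def Suc_le_eq;
      simp add: divide_simps; simp add: D_def algebra_simps)
qed

lemma unit_resistance_matched_unmatched_Y:
  assumes "i \<in> {1..p}" "j \<in> {1..n} - {1..p}"
  shows "unit_resistance m n p (Y i) (Y j) = (2 * real m - 1) / (real m * (real m - 1))
    + (real p - 1) / (real p * (real m - 1) * D)
    + (real m - real p) / (real p * real m * (real m - 1) * (D + real p))"
proof -
  have "i \<noteq> j" "p < j" using assms by auto
  thus ?thesis
    using assms p D mn_nonzero matched_nonzero[OF assms(1)]
    by (subst potential; simp add: image_iff sum_subtractf sum_negf of_bool_def Suc_le_eq;
      simp add: divide_simps; simp add: D_def algebra_simps)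
qed

lemma unit_resistance_matched_pair:
  assumes "i = j" "j \<in> {1..p}"
  shows "unit_resistance m n p (X i) (Y j)
    = (real m + real n) / D - real m * real n / (D * (D + real p))"
  using assms p D mn_nonzero matched_nonzero[OF assms(2)]
  by (subst potential; simp add: image_iff sum_subtractf sum_negf of_bool_def Suc_le_eq;
      simp add: divide_simps; simp add: D_def algebra_simps)

text \<open>As for a matched pair, \<open>A\<close> is m / (D + p). The numerator loses 2 because
  neither terminal's partner carries injected current.\<close>

lemma unit_resistance_matched_XY:
  assumes "i \<noteq> j" "i \<in> {1..p}" "j \<in> {1..p}"
  shows "unit_resistance m n p (X i) (Y j)
    = (real m + real n - 2) / D - real m * real n / (D * (D + real p))"
  using assms p D mn_nonzero matched_nonzero[OF assms(2)]
  by (subst potential; simp add: image_iff sum_subtractf sum_negf of_bool_def Suc_le_eq;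
      simp add: divide_simps; simp add: D_def algebra_simps)

lemma unit_resistance_matched_X_unmatched_Y:
  assumes "i \<in> {1..p}" "j \<in> {1..n} - {1..p}"
  shows "unit_resistance m n p (X i) (Y j) = 1 / real m
    + (real p - 1) * (real m - 1) / (real p * D)
    + (real m - real p) * (real m - 1) / (real p * real m * (D + real p))"
proof -
  have "i \<noteq> j" "p < j" using assms by auto
  thus ?thesis
    using assms p D mn_nonzero matched_nonzero[OF assms(1)]
    by (subst potential; simp add: image_iff sum_subtractf sum_negf of_bool_def Suc_le_eq;
      simp add: divide_simps; simp add: D_def algebra_simps)
qed

lemma unit_resistance_unmatched_X_matched_Y:
  assumes "i \<in> {1..m} - {1..p}" "j \<in> {1..p}"
  shows "unit_resistance m n p (X i) (Y j) = 1 / real n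
    + (real p - 1) * (real n - 1) / (real p * D)
    + (real n - real p) * (real n - 1) / (real p * real n * (D + real p))"
proof -
  have "i \<noteq> j" "p < i" "i \<in> {1..m}" using assms by auto
  \<comment> \<open>The quotient by \<open>D + real p\<close> is the value of \<open>A\<close> for a
    source at an unmatched \<open>X\<close> and a sink at a matched \<open>Y\<close>.\<close>
  hence "unit_resistance m n p (X i) (Y j)
      = 1 / real n - (real n - 1) * ((D / real n + 1) / (D + real p) - 1) / D"
    using assms(2) p
    by (subst potential; simp add: image_iff sum_subtractf sum_negf of_bool_def Suc_le_eq)
  \<comment> \<open>A partial fraction identity that holds with D as an independent
    variable.\<close>
  also have "\<dots> = 1 / real n + (real p - 1) * (real n - 1) / (real p * D)
      + (real n - real p) * (real n - 1) / (real p * real n * (D + real p))"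
    using D mn_nonzero matched_nonzero[OF assms(2)]
    by (simp add: divide_simps) (simp add: algebra_simps)
  finally show ?thesis .
qed

lemma unit_resistance_unmatched_XY:
  assumes "i \<in> {1..m} - {1..p}" "j \<in> {1..n} - {1..p}"
  shows "unit_resistance m n p (X i) (Y j)
    = 1 / real m + 1 / real n - D / (real m * real n * (D + real p))"
proof -
  have "p < i" "p < j" using assms by auto
  thus ?thesis
    using assms p D mn_nonzero
    by (subst potential; simp add: image_iff sum_subtractf sum_negf of_bool_def Suc_le_eq;
      simp add: divide_simps; simp add: D_def algebra_simps)
qed

end

section \<open>Assembly, and the degenerate case D = 0\<close>

theorem theorem5p7:
  fixes m n p :: nat
  assumes "m \<ge> 1" and "n \<ge> 1" and "p \<le> min m n"
    and "connected (with_proj (bipartite_minus_matching m n p))"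
  shows "(\<forall>i \<in> {1..m}. \<forall>j \<in> {1..m}.
        (i \<noteq> j \<and> i \<in> {1..p} \<and> j \<in> {1..p} \<longrightarrow>
          unit_resistance m n p (X i) (X j) = 2 * (real m - 1) / (real m * real n - real m - real n)) \<and>
        (i \<noteq> j \<and> i \<in> {1..m} - {1..p} \<and> j \<in> {1..m} - {1..p} \<longrightarrow>
          unit_resistance m n p (X i) (X j) = 2 / real n) \<and>
        (i \<in> {1..p} \<and> j \<in> {1..m} - {1..p} \<longrightarrow>
          unit_resistance m n p (X i) (X j) =
            (2 * real n - 1) / (real n * (real n - 1))
            + (real p - 1) / (real p * (real n - 1) * (real m * real n - real m - real n))
            + (real n - real p) / (real p * real n * (real n - 1) * (real m * real n - real m - real n + real p))))
    \<and> (\<forall>i \<in> {1..n}. \<forall>j \<in> {1..n}.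
        (i \<noteq> j \<and> i \<in> {1..p} \<and> j \<in> {1..p} \<longrightarrow>
          unit_resistance m n p (Y i) (Y j) = 2 * (real n - 1) / (real m * real n - real m - real n)) \<and>
        (i \<noteq> j \<and> i \<in> {1..n} - {1..p} \<and> j \<in> {1..n} - {1..p} \<longrightarrow>
          unit_resistance m n p (Y i) (Y j) = 2 / real m) \<and>
        (i \<in> {1..p} \<and> j \<in> {1..n} - {1..p} \<longrightarrow>
          unit_resistance m n p (Y i) (Y j) =
            (2 * real m - 1) / (real m * (real m - 1))
            + (real p - 1) / (real p * (real m - 1) * (real m * real n - real m - real n))
            + (real m - real p) / (real p * real m * (real m - 1) * (real m * real n - real m - real n + real p))))
    \<and> (\<forall>i \<in> {1..m}. \<forall>j \<in> {1..n}.
        (i = j \<and> j \<in> {1..p} \<and> real m * real n - real m - real n \<noteq> 0 \<longrightarrow>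
          unit_resistance m n p (X i) (Y j) =
            (real m + real n) / (real m * real n - real m - real n)
            - real m * real n / ((real m * real n - real m - real n) * (real m * real n - real m - real n + real p))) \<and>
        (i \<noteq> j \<and> i \<in> {1..p} \<and> j \<in> {1..p} \<longrightarrow>
          unit_resistance m n p (X i) (Y j) =
            (real m + real n - 2) / (real m * real n - real m - real n)
            - real m * real n / ((real m * real n - real m - real n) * (real m * real n - real m - real n + real p))) \<and>
        (i \<in> {1..p} \<and> j \<in> {1..n} - {1..p} \<longrightarrow>
          unit_resistance m n p (X i) (Y j) =
            1 / real m
            + (real p - 1) * (real m - 1) / (real p * (real m * real n - real m - real n))
            + (real m - real p) * (real m - 1) / (real p * real m * (real m * real n - real m - real n + real p))) \<and>
        (i \<in> {1..m} - {1..p} \<and> j \<in> {1..p} \<longrightarrow>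
          unit_resistance m n p (X i) (Y j) =
            1 / real n
            + (real p - 1) * (real n - 1) / (real p * (real m * real n - real m - real n))
            + (real n - real p) * (real n - 1) / (real p * real n * (real m * real n - real m - real n + real p))) \<and>
        (i \<in> {1..m} - {1..p} \<and> j \<in> {1..n} - {1..p} \<and> real m * real n - real m - real n + real p \<noteq> 0 \<longrightarrow>
          unit_resistance m n p (X i) (Y j) =
            1 / real m + 1 / real n
            - (real m * real n - real m - real n) / (real m * real n * (real m * real n - real m - real n + real p))))"
proof -
  define D where "D = real m * real n - real m - real n"
  have p: "p \<le> m" "p \<le> n" using assms(3) by auto
  note conn = connected_bipartite[OF assms(1-3) _ assms(4)]
  have D_eq: "D = (real m - 1) * (real n - 1) - 1"
    by (simp add: D_def algebra_simps)
  show ?thesis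
  proof (cases "D = 0")
    case False
    \<comment> \<open>If p > 0, connectedness gives m, n \<ge> 2, hence D \<ge> 0 and D + p >
      0.\<close>
    have Dp: "D + real p \<noteq> 0"
    proof (cases "p = 0")
      case False
      hence "1 * 1 \<le> (real m - 1) * (real n - 1)"
        using conn by (intro mult_mono) auto
      thus ?thesis using False D_eq by linarith
    qed (use \<open>D \<noteq> 0\<close> in simp)
    have matched: "p > 0 \<longrightarrow> m \<ge> 2 \<and> n \<ge> 2" using conn by blast
    note facts = assms(1,2) p matched D_def False Dp
    show ?thesis
      unfolding D_def[symmetric]
      by (intro conjI ballI impI; elim conjE;
          rule unit_resistance_matched_X[OF facts] unit_resistance_matched_Y[OF facts]
            unit_resistance_matched_unmatched_X[OF facts]
            unit_resistance_matched_unmatched_Y[OF facts]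
            unit_resistance_matched_pair[OF facts] unit_resistance_matched_XY[OF facts]
            unit_resistance_matched_X_unmatched_Y[OF facts]
            unit_resistance_unmatched_X_matched_Y[OF facts]
            unit_resistance_unmatched_XY[OF facts]
            unit_resistance_unmatched_X[OF assms(2) p]
            unit_resistance_unmatched_Y[OF assms(1) p];
          assumption)
  next
    case True
    hence "real ((m - 1) * (n - 1)) = real 1"
      using D_eq assms(1,2) by (simp add: of_nat_diff)
    hence "(m - 1) * (n - 1) = 1" by (simp only: of_nat_eq_iff)
    hence mn: "m = 2" "n = 2" by auto
    have two: "{Suc 0..2} = {1, 2}" "{1, 2} - {1} = {2::nat}" by auto
    have "p = 0 \<or> p = 1"
      using conn p mn by fastforce
    \<comment> \<open>For p = 0 the guard D + p \<noteq> 0 fails, leaving only pairs on one side.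
      For p = 1 the guard D \<noteq> 0 discards the matched pair, and the terms with numerator p - 1
      and divisor D are 0 / 0 = 0.\<close>
    thus ?thesis
      using unit_resistance_unmatched_X[OF assms(2) p] unit_resistance_unmatched_Y[OF assms(1) p]
        unit_resistance_path mn two
      by (elim disjE) simp_all
  qed
qed

end
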